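(* Let $n=2$. Let $\theta,\theta'\in\Omega$ with $\theta'\in M$, $\theta\notin M$, and let $\theta^\ast=(\bar\theta,\bar\theta)\in M$ with $\bar\theta=\tfrac12(\theta^1+\theta^2)$. Suppose the three vertices $\theta,\theta^\ast,\theta'$ are joined by $g_\alpha$-geodesic segments (the side $\theta^\ast\theta'$ lying in $M$) forming a simple, non-degenerate geodesic triangle, i.e. the three segments meet only at the stated vertices and together bound a single embedded disk $\triangle\subset\Omega$ (at $\alpha=1$ each side is the shorter geodesic arc, so that $\triangle$ is unambiguous). Let $\Sigma(\alpha)$ denote the sum of the three interior angles of $\triangle$ measured with respect to $g_\alpha$. Then $\Sigma(1)>\pi$ and $\Sigma(0)<\pi$, for every such triangle.
   Context: $\Omega:=\{\theta=(\theta^1,\theta^2)\in\mathbb R^2:e^{\theta^1}+e^{\theta^2}<1\}$; $\Psi_+(\theta):=\log(1+e^{\theta^1}+e^{\theta^2})$, $\Psi_-(\theta):=-\log(1-e^{\theta^1}-e^{\theta^2})$, $\Psi_\alpha:=\alpha\Psi_++(1-\alpha)\Psi_-$ for $\alpha\in[0,1]$; $g_\alpha:=\operatorname{Hess}_\theta\Psi_\alpha$ is a Riemannian metric on $\Omega$. $M:=\{\theta\in\Omega:\theta^1=\theta^2\}$. Geodesics are those of the Levi-Civita connection of $g_\alpha$; the triangle depends on $\alpha$, and the two conclusions concern the triangles for $g_1$ and for $g_0$ respectively. *)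

theory Defs
  imports "HOL-Analysis.Analysis"
begin

definition Omega :: "(real^2) set" where
  "Omega = {\<theta>. exp (\<theta>$1) + exp (\<theta>$2) < 1}"

definition Diag :: "(real^2) set" where
  "Diag = {\<theta> \<in> Omega. \<theta>$1 = \<theta>$2}"

definition Psi_plus :: "real^2 \<Rightarrow> real" where
  "Psi_plus \<theta> = ln (1 + exp (\<theta>$1) + exp (\<theta>$2))"

definition Psi_minus :: "real^2 \<Rightarrow> real" where
  "Psi_minus \<theta> = - ln (1 - exp (\<theta>$1) - exp (\<theta>$2))"

definition Psi :: "real \<Rightarrow> real^2 \<Rightarrow> real" where
  "Psi \<alpha> \<theta> = \<alpha> * Psi_plus \<theta> + (1 - \<alpha>) * Psi_minus \<theta>"

definition partial_deriv :: "2 \<Rightarrow> (real^2 \<Rightarrow> real) \<Rightarrow> real^2 \<Rightarrow> real" where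
  "partial_deriv i f x = deriv (\<lambda>t. f (x + t *\<^sub>R axis i 1)) 0"

definition hess_metric :: "real \<Rightarrow> real^2 \<Rightarrow> real^2^2" where
  "hess_metric \<alpha> \<theta> = (\<chi> i j. partial_deriv i (partial_deriv j (Psi \<alpha>)) \<theta>)"

definition g_inner :: "real \<Rightarrow> real^2 \<Rightarrow> real^2 \<Rightarrow> real^2 \<Rightarrow> real" where
  "g_inner \<alpha> \<theta> v w = v \<bullet> (hess_metric \<alpha> \<theta> *v w)"

definition g_norm :: "real \<Rightarrow> real^2 \<Rightarrow> real^2 \<Rightarrow> real" where
  "g_norm \<alpha> \<theta> v = sqrt (g_inner \<alpha> \<theta> v v)"

text \<open>Christoffel symbols (upper index first) of the Levi-Civita connection in the global
  coordinates \<open>(\<theta>$1, \<theta>$2)\<close>.\<close>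

definition christoffel :: "real \<Rightarrow> 2 \<Rightarrow> 2 \<Rightarrow> 2 \<Rightarrow> real^2 \<Rightarrow> real" where
  "christoffel \<alpha> k i j \<theta> = (1/2) * (\<Sum>l\<in>UNIV. matrix_inv (hess_metric \<alpha> \<theta>) $ k $ l *
      (partial_deriv i (\<lambda>x. hess_metric \<alpha> x $ j $ l) \<theta>
     + partial_deriv j (\<lambda>x. hess_metric \<alpha> x $ i $ l) \<theta>
     - partial_deriv l (\<lambda>x. hess_metric \<alpha> x $ i $ j) \<theta>))"

text \<open>Curves are parametrised by \<open>{0..1}\<close>; derivatives at the end points are one-sided.\<close>

definition velocity :: "(real \<Rightarrow> real^2) \<Rightarrow> real \<Rightarrow> real^2" where
  "velocity \<gamma> t = vector_derivative \<gamma> (at t within {0..1})"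

definition geodesic :: "real \<Rightarrow> (real \<Rightarrow> real^2) \<Rightarrow> bool" where
  "geodesic \<alpha> \<gamma> \<longleftrightarrow> (\<exists>v a. \<forall>t\<in>{0..1}.
      \<gamma> t \<in> Omega \<and>
      (\<gamma> has_vector_derivative v t) (at t within {0..1}) \<and>
      (v has_vector_derivative a t) (at t within {0..1}) \<and>
      (\<forall>k. a t $ k + (\<Sum>i\<in>UNIV. \<Sum>j\<in>UNIV. christoffel \<alpha> k i j (\<gamma> t) * v t $ i * v t $ j) = 0))"

definition geodesic_segment :: "real \<Rightarrow> real^2 \<Rightarrow> real^2 \<Rightarrow> (real \<Rightarrow> real^2) \<Rightarrow> bool" where
  "geodesic_segment \<alpha> p q \<gamma> \<longleftrightarrow>
     geodesic \<alpha> \<gamma> \<and> arc \<gamma> \<and> pathstart \<gamma> = p \<and> pathfinish \<gamma> = q"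

definition g_length :: "real \<Rightarrow> (real \<Rightarrow> real^2) \<Rightarrow> real" where
  "g_length \<alpha> \<gamma> = integral {0..1} (\<lambda>t. g_norm \<alpha> (\<gamma> t) (velocity \<gamma> t))"

definition shorter_arc :: "real \<Rightarrow> (real \<Rightarrow> real^2) \<Rightarrow> bool" where
  "shorter_arc \<alpha> \<gamma> \<longleftrightarrow>
     (\<forall>\<delta>. geodesic_segment \<alpha> (pathstart \<gamma>) (pathfinish \<gamma>) \<delta> \<longrightarrow> g_length \<alpha> \<gamma> \<le> g_length \<alpha> \<delta>)"

text \<open>A simple geodesic triangle with vertices \<open>p\<close>, \<open>q\<close>, \<open>r\<close>, consecutive sides \<open>a\<close> (from \<open>p\<close>
  to \<open>q\<close>), \<open>b\<close> (from \<open>q\<close> to \<open>r\<close>), \<open>c\<close> (from \<open>r\<close> to \<open>p\<close>), bounding the embedded closed disk \<open>D\<close>.\<close>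

definition geodesic_triangle ::
  "real \<Rightarrow> real^2 \<Rightarrow> real^2 \<Rightarrow> real^2 \<Rightarrow> (real \<Rightarrow> real^2) \<Rightarrow> (real \<Rightarrow> real^2) \<Rightarrow> (real \<Rightarrow> real^2) \<Rightarrow>
   (real^2) set \<Rightarrow> bool" where
  "geodesic_triangle \<alpha> p q r a b c D \<longleftrightarrow>
     geodesic_segment \<alpha> p q a \<and> geodesic_segment \<alpha> q r b \<and> geodesic_segment \<alpha> r p c \<and>
     path_image a \<inter> path_image b = {q} \<and>
     path_image b \<inter> path_image c = {r} \<and>
     path_image c \<inter> path_image a = {p} \<and>
     D homeomorphic (cball 0 1 :: (real^2) set) \<and>
     frontier D = path_image a \<union> path_image b \<union> path_image c \<and>
     D \<subseteq> Omega"

definition g_angle :: "real \<Rightarrow> real^2 \<Rightarrow> real^2 \<Rightarrow> real^2 \<Rightarrow> real" where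
  "g_angle \<alpha> p v w = arccos (g_inner \<alpha> p v w / (g_norm \<alpha> p v * g_norm \<alpha> p w))"

text \<open>The angle of \<open>D\<close> at the vertex where the side \<open>\<gamma>\<close> ends and the next side \<open>\<delta>\<close> starts. The
  tangent vectors \<open>v\<close> and \<open>w\<close> of the two sides, pointing away from the vertex, cut the tangent plane
  into two sectors; the one into which \<open>D\<close> points is the convex one, of angle \<open>g_angle\<close>, iff \<open>D\<close>
  contains the initial points of the ray along its bisector, and otherwise the reflex one.\<close>

definition interior_angle ::
  "real \<Rightarrow> (real^2) set \<Rightarrow> (real \<Rightarrow> real^2) \<Rightarrow> (real \<Rightarrow> real^2) \<Rightarrow> real" where
  "interior_angle \<alpha> D \<gamma> \<delta> =
    (let p = pathstart \<delta>;
         v = - velocity \<gamma> 1;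
         w = velocity \<delta> 0;
         u = v /\<^sub>R g_norm \<alpha> p v + w /\<^sub>R g_norm \<alpha> p w
     in if \<forall>\<^sub>F t in at_right 0. p + t *\<^sub>R u \<in> D then g_angle \<alpha> p v w
        else 2 * pi - g_angle \<alpha> p v w)"

definition angle_sum ::
  "real \<Rightarrow> (real^2) set \<Rightarrow> (real \<Rightarrow> real^2) \<Rightarrow> (real \<Rightarrow> real^2) \<Rightarrow> (real \<Rightarrow> real^2) \<Rightarrow> real" where
  "angle_sum \<alpha> D a b c = interior_angle \<alpha> D c a + interior_angle \<alpha> D a b + interior_angle \<alpha> D b c"

definition midpoint_diag :: "real^2 \<Rightarrow> real^2" where
  "midpoint_diag \<theta> = (\<chi> i. (\<theta>$1 + \<theta>$2) / 2)"

end

theory Submission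
  imports Defs
begin

text \<open>
  In the coordinates \<open>y = (exp (\<theta>$1 / 2), exp (\<theta>$2 / 2))\<close> the metric for \<open>\<alpha> = 1\<close> is four times the
  round metric in gnomonic projection, and the one for \<open>\<alpha> = 0\<close> is four times the Klein model of
  the hyperbolic plane. Hence geodesics are Euclidean line segments in \<open>y\<close>, a geodesic triangle is
  a Euclidean triangle whose disk is its convex hull (so each interior angle is the convex one), and
  the angle sum is a matter of spherical and hyperbolic trigonometry: by the laws of cosines,
  \<open>cos (A + B) + cos C\<close> is a positive multiple of \<open>cos c - 1\<close> and \<open>cosh c - 1\<close> respectively.
\<close>

section \<open>The metric and its Christoffel symbols\<close>

text \<open>The sign \<open>k\<close> stays symbolic because the algebraic identities rest on
  \<open>k * k = 1\<close>; the two cases part only where inequalities enter. The disk is given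
  merely by its topology and its frontier, and an angle counts as reflex unless the bisector enters
  the disk, so the disk has to be identified before any angle can be computed. Vertices are lifted
  to vectors \<open>(1, y)\<close> that are not normalised to the sphere or hyperboloid; angles and
  side lengths are read off their Gram matrix, which turns the laws of cosines into polynomial
  identities. The resulting cosine inequality settles the spherical case at once, but in the
  hyperbolic case it still allows \<open>A + B > pi + C\<close>, and a cyclic relabelling of the
  vertices is needed to exclude this.\<close>

text \<open>The parameter \<open>k\<close> is \<open>-1\<close> for the spherical metric (\<open>\<alpha> = 1\<close>) and \<open>1\<close> for the hyperbolic one
  (\<open>\<alpha> = 0\<close>); both curvatures are \<open>-k/4\<close>.\<close>

abbreviation weight :: "real \<Rightarrow> real" where
  "weight k \<equiv> (1 - k) / 2"

text \<open>The argument of the logarithm in the potential, for either sign; in the chart it becomes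
  the square of the lift \<open>(1, y)\<close> under the ambient form.\<close>

definition conf :: "real \<Rightarrow> real^2 \<Rightarrow> real" where
  "conf k \<theta> = 1 - k * (exp (\<theta>$1) + exp (\<theta>$2))"

lemma conf_pos: "k = 1 \<or> k = -1 \<Longrightarrow> \<theta> \<in> Omega \<Longrightarrow> conf k \<theta> > 0"
  by (auto simp: conf_def Omega_def) (smt (verit) exp_gt_zero)

lemma open_Omega: "open Omega"
  unfolding Omega_def by (intro open_Collect_less continuous_intros)

text \<open>A derivative depends only on values near \<open>x\<close>, and \<open>Omega\<close> is
  open, so a closed form valid only on \<open>Omega\<close> may be differentiated instead. This is
  what permits iterating \<open>partial_deriv\<close>.\<close>

lemma partial_derivI:
  assumes "x \<in> Omega" and eq: "\<And>z. z \<in> Omega \<Longrightarrow> f z = F z"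
    and D: "((\<lambda>t. F (x + t *\<^sub>R axis i 1)) has_real_derivative d) (at 0)"
  shows "partial_deriv i f x = d"
  unfolding partial_deriv_def
proof (rule DERIV_imp_deriv)
  have "((\<lambda>t::real. x + t *\<^sub>R axis i (1::real)) \<longlongrightarrow> x + 0 *\<^sub>R axis i 1) (at 0)"
    by (intro tendsto_intros)
  then have "\<forall>\<^sub>F t in at 0. x + t *\<^sub>R axis i (1::real) \<in> Omega"
    using topological_tendstoD open_Omega \<open>x \<in> Omega\<close> by fastforce
  then have "\<forall>\<^sub>F t in nhds 0. x + t *\<^sub>R axis i (1::real) \<in> Omega"
    using \<open>x \<in> Omega\<close> by (simp add: eventually_nhds_conv_at)
  then have "\<forall>\<^sub>F t in nhds 0. f (x + t *\<^sub>R axis i 1) = F (x + t *\<^sub>R axis i 1)"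
    by eventually_elim (rule eq)
  then show "((\<lambda>t. f (x + t *\<^sub>R axis i 1)) has_real_derivative d) (at 0)"
    using D by (simp add: DERIV_cong_ev)
qed

lemma DERIV_exp_axis:
  "((\<lambda>t. exp ((x + t *\<^sub>R axis i (1::real)) $ j)) has_real_derivative of_bool (i = j) * exp (x $ j)) (at 0)"
  by (auto simp: axis_def intro!: derivative_eq_intros)

lemma DERIV_conf_axis:
  "((\<lambda>t. conf k (x + t *\<^sub>R axis i (1::real))) has_real_derivative - k * exp (x $ i)) (at 0)"
  unfolding conf_def
  by (rule derivative_eq_intros DERIV_exp_axis refl)+ (use exhaust_2[of i] in auto)

context
  fixes k :: real
  assumes k: "k = 1 \<or> k = -1"
begin

lemma Psi_eq: "Psi (weight k) \<theta> = - k * ln (conf k \<theta>)"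
  using k by (auto simp: Psi_def Psi_plus_def Psi_minus_def conf_def algebra_simps)

lemma partial_Psi:
  assumes "\<theta> \<in> Omega"
  shows "partial_deriv i (Psi (weight k)) \<theta> = exp (\<theta> $ i) / conf k \<theta>"
proof (rule partial_derivI[OF assms Psi_eq])
  have s: "conf k (\<theta> + 0 *\<^sub>R axis i 1) > 0" using conf_pos[OF k assms] by simp
  show "((\<lambda>t. - k * ln (conf k (\<theta> + t *\<^sub>R axis i 1))) has_real_derivative exp (\<theta> $ i) / conf k \<theta>) (at 0)"
    by (rule DERIV_conf_axis derivative_eq_intros refl s)+ (use k s in auto)
qed

lemma hess_metric_eq:
  assumes "\<theta> \<in> Omega"
  shows "hess_metric (weight k) \<theta> $ i $ j =
     of_bool (i = j) * exp (\<theta> $ i) / conf k \<theta> + k * exp (\<theta> $ i) * exp (\<theta> $ j) / (conf k \<theta>)\<^sup>2" (is "_ = ?r")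
  unfolding hess_metric_def vec_lambda_beta
proof (rule partial_derivI[OF assms partial_Psi])
  have s: "conf k (\<theta> + 0 *\<^sub>R axis i 1) \<noteq> 0" using conf_pos[OF k assms] by simp
  show "((\<lambda>t. exp ((\<theta> + t *\<^sub>R axis i 1) $ j) / conf k (\<theta> + t *\<^sub>R axis i 1)) has_real_derivative ?r) (at 0)"
    by (rule DERIV_conf_axis DERIV_exp_axis derivative_eq_intros refl s)+
      (use s in \<open>auto simp: field_simps power2_eq_square\<close>)
qed

text \<open>These are the third derivatives of a potential, so the expression is symmetric in
  \<open>i\<close>, \<open>j\<close>, \<open>l\<close>, although it is not written that way. The
  factor 2 in the last term is \<open>2 * k * k\<close>.\<close>

lemma partial_hess_metric:
  assumes "\<theta> \<in> Omega"
  shows "partial_deriv l (\<lambda>x. hess_metric (weight k) x $ i $ j) \<theta> =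
     of_bool (i = j) * (of_bool (l = i) * exp (\<theta> $ i) / conf k \<theta> + k * exp (\<theta> $ i) * exp (\<theta> $ l) / (conf k \<theta>)\<^sup>2)
     + k * (of_bool (l = i) + of_bool (l = j)) * exp (\<theta> $ i) * exp (\<theta> $ j) / (conf k \<theta>)\<^sup>2
     + 2 * exp (\<theta> $ i) * exp (\<theta> $ j) * exp (\<theta> $ l) / (conf k \<theta>) ^ 3" (is "_ = ?r")
proof (rule partial_derivI[OF assms hess_metric_eq])
  let ?x = "\<lambda>t. \<theta> + t *\<^sub>R axis l 1"
  have s: "conf k (?x 0) \<noteq> 0" and s2: "(conf k (?x 0))\<^sup>2 \<noteq> 0" 
    using conf_pos[OF k assms] by auto
  show "((\<lambda>t. of_bool (i = j) * exp (?x t $ i) / conf k (?x t) + 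
     k * exp (?x t $ i) * exp (?x t $ j) / (conf k (?x t))\<^sup>2) has_real_derivative ?r) (at 0)"
    by (rule DERIV_conf_axis DERIV_exp_axis derivative_eq_intros refl s s2)+
      (use k s in \<open>auto simp: divide_simps, auto simp: algebra_simps eval_nat_numeral\<close>)
qed

text \<open>The metric is a diagonal matrix plus one of rank one, so the inverse comes from the
  Sherman-Morrison formula; its denominator simplifies to
  \<open>1 / conf k \<theta>\<close>.\<close>

lemma matrix_inv_hess_metric:
  assumes "\<theta> \<in> Omega"
  shows "matrix_inv (hess_metric (weight k) \<theta>) $ i $ j = conf k \<theta> * (of_bool (i = j) / exp (\<theta> $ i) - k)"
proof -
  define B :: "real^2^2" where "B = (\<chi> i j. conf k \<theta> * (of_bool (i = j) / exp (\<theta> $ i) - k))"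
  let ?A = "hess_metric (weight k) \<theta>"
  have s: "conf k \<theta> \<noteq> 0" using conf_pos[OF k assms] by simp
  have AB: "?A ** B = mat 1"
    using k s
    by (auto simp: vec_eq_iff forall_2 matrix_matrix_mult_def mat_def sum_2 hess_metric_eq[OF assms] B_def,
        simp_all add: field_simps power2_eq_square, simp_all add: conf_def algebra_simps)
  then have "B ** ?A = mat 1"
    using matrix_left_right_inverse by blast
  then have "\<exists>C. ?A ** C = mat 1 \<and> C ** ?A = mat 1"
    using AB by blast
  then have "matrix_inv ?A ** ?A = mat 1"
    unfolding matrix_inv_def by (metis (mono_tags, lifting) someI_ex)
  then have "matrix_inv ?A = B"
    using AB by (metis matrix_mul_assoc matrix_mul_lid matrix_mul_rid)
  then show ?thesis by (simp add: B_def)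
qed

text \<open>The geodesic equation sees the symbols only through their contraction with
  \<open>v\<close> twice, so they are never computed one by one. By symmetry of the third
  derivatives the three terms collapse to a single one.\<close>

lemma christoffel_lowered_quadratic:
  fixes v :: "real^2"
  assumes "\<theta> \<in> Omega"
  defines "w \<equiv> exp (\<theta>$1) * v$1 + exp (\<theta>$2) * v$2"
    and "z \<equiv> exp (\<theta>$1) * (v$1)\<^sup>2 + exp (\<theta>$2) * (v$2)\<^sup>2"
  shows "(\<Sum>i\<in>UNIV. \<Sum>j\<in>UNIV. (partial_deriv i (\<lambda>x. hess_metric (weight k) x $ j $ l) \<theta>
     + partial_deriv j (\<lambda>x. hess_metric (weight k) x $ i $ l) \<theta>
     - partial_deriv l (\<lambda>x. hess_metric (weight k) x $ i $ j) \<theta>) * v $ i * v $ j) =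
     exp (\<theta>$l) * ((v$l)\<^sup>2 / conf k \<theta> + k * (z + 2 * v$l * w) / (conf k \<theta>)\<^sup>2 + 2 * w\<^sup>2 / (conf k \<theta>) ^ 3)"
proof -
  have s: "conf k \<theta> \<noteq> 0" using conf_pos[OF k assms(1)] by simp
  have l: "l = 1 \<or> l = 2" by (rule exhaust_2)
  show ?thesis
    unfolding sum_2 partial_hess_metric[OF assms(1)] w_def z_def
    using l s by (auto simp: divide_simps) (simp_all add: algebra_simps eval_nat_numeral)
qed

lemma christoffel_quadratic:
  assumes "\<theta> \<in> Omega"
  shows "(\<Sum>i\<in>UNIV. \<Sum>j\<in>UNIV. christoffel (weight k) m i j \<theta> * v $ i * v $ j) =
    (v $ m)\<^sup>2 / 2 + k * v $ m * (exp (\<theta>$1) * v$1 + exp (\<theta>$2) * v$2) / conf k \<theta>"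
proof -
  define P where "P i j l = partial_deriv i (\<lambda>x. hess_metric (weight k) x $ j $ l) \<theta>
     + partial_deriv j (\<lambda>x. hess_metric (weight k) x $ i $ l) \<theta>
     - partial_deriv l (\<lambda>x. hess_metric (weight k) x $ i $ j) \<theta>" for i j l
  define s where "s = conf k \<theta>"
  define p where "p = exp (\<theta>$1)"
  define q where "q = exp (\<theta>$2)"
  have s: "s \<noteq> 0" using conf_pos[OF k assms(1)] by (simp add: s_def)
  have pq: "p \<noteq> 0" "q \<noteq> 0" by (auto simp: p_def q_def)
  \<comment> \<open>Eliminating \<open>q\<close> through the definition of \<open>conf\<close> makes
    the terms free of \<open>v $ m\<close> cancel when the index is raised.\<close>
  have q': "q = k * (1 - s) - p" using k by (auto simp: s_def p_def q_def conf_def)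
  have m: "m = 1 \<or> m = 2" by (rule exhaust_2)
  have "(\<Sum>i\<in>UNIV. \<Sum>j\<in>UNIV. christoffel (weight k) m i j \<theta> * v $ i * v $ j) =
    1/2 * (\<Sum>l\<in>UNIV. matrix_inv (hess_metric (weight k) \<theta>) $ m $ l * (\<Sum>i\<in>UNIV. \<Sum>j\<in>UNIV. P i j l * v $ i * v $ j))"
    unfolding christoffel_def P_def[symmetric] sum_2 by (simp add: algebra_simps)
  also have "\<dots> = (v $ m)\<^sup>2 / 2 + k * v $ m * (p * v$1 + q * v$2) / s"
    unfolding P_def christoffel_lowered_quadratic[OF assms]
    unfolding sum_2 matrix_inv_hess_metric[OF assms] s_def[symmetric]
    using m k s pq
    by (auto simp flip: p_def q_def simp: divide_simps, simp_all add: q',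
        simp_all add: algebra_simps eval_nat_numeral)
  finally show ?thesis by (simp add: s_def p_def q_def)
qed

end

section \<open>Geodesics\<close>

definition chart :: "real^2 \<Rightarrow> real^2" where
  "chart \<theta> = (\<chi> i. exp (\<theta> $ i / 2))"

definition chart_deriv :: "real^2 \<Rightarrow> real^2 \<Rightarrow> real^2" where
  "chart_deriv \<theta> v = (\<chi> i. exp (\<theta> $ i / 2) * v $ i / 2)"

lemma exp_half_square: "exp (x / 2) * exp (x / 2) = exp (x :: real)"
  by (simp flip: exp_add)

lemma conf_chart: "conf k \<theta> = 1 - k * (chart \<theta> \<bullet> chart \<theta>)"
  by (simp add: conf_def chart_def inner_vec_def sum_2 exp_half_square)

lemma inj_chart: "inj chart"
  by (rule injI) (simp add: chart_def vec_eq_iff)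

context
  fixes k :: real
  assumes k: "k = 1 \<or> k = -1"
begin

text \<open>The factor 4 comes from the halved exponents: the differential of the chart carries a
  factor 1/2 in each argument.\<close>

lemma g_inner_chart:
  assumes "\<theta> \<in> Omega"
  shows "g_inner (weight k) \<theta> v w = 4 * (chart_deriv \<theta> v \<bullet> chart_deriv \<theta> w / conf k \<theta> +
    k * (chart \<theta> \<bullet> chart_deriv \<theta> v) * (chart \<theta> \<bullet> chart_deriv \<theta> w) / (conf k \<theta>)\<^sup>2)"
proof -
  have s: "conf k \<theta> \<noteq> 0" using conf_pos[OF k assms(1)] by simp
  have e: "exp (x / 2) * (exp (x / 2) * z) = exp x * z" for x z :: real
    by (simp add: exp_half_square flip: mult.assoc)
  show ?thesis
    using s
    by (simp add: g_inner_def inner_vec_def matrix_vector_mult_def sum_2 hess_metric_eq[OF k assms]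
        chart_def chart_deriv_def divide_simps)
      (simp add: algebra_simps power2_eq_square exp_half_square e)
qed

text \<open>With \<open>y = chart (\<gamma> t)\<close>, \<open>s = conf k (\<gamma> t)\<close> and \<open>X = (1, y) / sqrt s\<close> the position vector on the
  sphere or hyperboloid, the bivector \<open>X \<and> X'\<close> is constant along geodesics; its first components are \<open>y' / s\<close>.\<close>

lemma geodesic_first_integral:
  assumes "geodesic (weight k) \<gamma>"
  obtains C where "\<And>t. t \<in> {0..1} \<Longrightarrow> \<gamma> t \<in> Omega"
    "\<And>t i. t \<in> {0..1} \<Longrightarrow>
      ((\<lambda>t. chart (\<gamma> t) $ i) has_real_derivative conf k (\<gamma> t) * C $ i) (at t within {0..1})"
    "\<And>t. t \<in> {0..1} \<Longrightarrow> chart_deriv (\<gamma> t) (velocity \<gamma> t) = conf k (\<gamma> t) *\<^sub>R C"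
    "continuous_on {0..1} (\<lambda>t. conf k (\<gamma> t))"
proof -
  obtain v a where va: "\<And>t. t \<in> {0..1} \<Longrightarrow> \<gamma> t \<in> Omega"
      "\<And>t. t \<in> {0..1} \<Longrightarrow> (\<gamma> has_vector_derivative v t) (at t within {0..1})"
      "\<And>t. t \<in> {0..1} \<Longrightarrow> (v has_vector_derivative a t) (at t within {0..1})"
      "\<And>t i. t \<in> {0..1} \<Longrightarrow> a t $ i + 
         (\<Sum>j\<in>UNIV. \<Sum>l\<in>UNIV. christoffel (weight k) i j l (\<gamma> t) * v t $ j * v t $ l) = 0"
    using assms unfolding geodesic_def by blast
  have d1: "((\<lambda>t. \<gamma> t $ i) has_real_derivative v t $ i) (at t within {0..1})" if "t \<in> {0..1}" for i t
    unfolding has_real_derivative_iff_has_vector_derivative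
    by (rule bounded_linear.has_vector_derivative[OF bounded_linear_vec_nth va(2)[OF that]])
  have d2: "((\<lambda>t. v t $ i) has_real_derivative a t $ i) (at t within {0..1})" if "t \<in> {0..1}" for i t
    unfolding has_real_derivative_iff_has_vector_derivative
    by (rule bounded_linear.has_vector_derivative[OF bounded_linear_vec_nth va(3)[OF that]])
  let ?w = "\<lambda>t. exp (\<gamma> t $ 1) * v t $ 1 + exp (\<gamma> t $ 2) * v t $ 2"
  have d0: "((\<lambda>t. conf k (\<gamma> t)) has_real_derivative - k * ?w t) (at t within {0..1})"
    if "t \<in> {0..1}" for t
    unfolding conf_def by (rule d1[OF that] derivative_eq_intros refl)+ (simp add: algebra_simps)
  have d3: "((\<lambda>t. chart (\<gamma> t) $ i) has_real_derivative chart_deriv (\<gamma> t) (v t) $ i) (at t within {0..1})"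
    if "t \<in> {0..1}" for t i
    unfolding chart_def chart_deriv_def vec_lambda_beta
    by (auto intro!: derivative_eq_intros d1[OF that])
  have s: "conf k (\<gamma> t) \<noteq> 0" if "t \<in> {0..1}" for t
    using conf_pos[OF k va(1)[OF that]] by simp
  \<comment> \<open>The exponential in the chart absorbs the term \<open>(v $ m)^2 / 2\<close> of
    the geodesic equation, and division by \<open>conf\<close> absorbs the other one.\<close>
  have "((\<lambda>t. chart_deriv (\<gamma> t) (v t) $ i / conf k (\<gamma> t)) has_real_derivative 0) (at t within {0..1})"
    if "t \<in> {0..1}" for t i
  proof -
    have a: "a t $ i = - ((v t $ i)\<^sup>2 / 2 + k * v t $ i * ?w t / conf k (\<gamma> t))"
      using va(4)[OF that, of i] unfolding christoffel_quadratic[OF k va(1)[OF that]] by simp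
    show ?thesis
      unfolding chart_deriv_def vec_lambda_beta
      apply (rule d0[OF that] d1[OF that] d2[OF that] s[OF that] derivative_eq_intros refl | simp; fail)+
      using s[OF that] unfolding a by (simp add: divide_simps) (simp add: algebra_simps power2_eq_square)
  qed
  then have "\<exists>c. \<forall>t\<in>{0..1}. chart_deriv (\<gamma> t) (v t) $ i / conf k (\<gamma> t) = c" for i
    by (intro has_field_derivative_zero_constant convex_real_interval)
  then obtain c where c: "\<And>i t. t \<in> {0..1} \<Longrightarrow> chart_deriv (\<gamma> t) (v t) $ i / conf k (\<gamma> t) = c i"
    by metis
  have cd: "chart_deriv (\<gamma> t) (v t) $ i = conf k (\<gamma> t) * c i" if "t \<in> {0..1}" for t i
    using c[OF that, of i] s[OF that] by (simp add: field_simps)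
  have vel: "velocity \<gamma> t = v t" if "t \<in> {0..1}" for t
    unfolding velocity_def using that va(2) by (intro vector_derivative_within_closed_interval) auto
  show ?thesis
  proof (rule that[of "\<chi> i. c i"])
    show "continuous_on {0..1} (\<lambda>t. conf k (\<gamma> t))"
      using d0 by (intro DERIV_continuous_on)
    show "chart_deriv (\<gamma> t) (velocity \<gamma> t) = conf k (\<gamma> t) *\<^sub>R (\<chi> i. c i)" if "t \<in> {0..1}" for t
      unfolding vel[OF that] by (simp add: vec_eq_iff cd[OF that])
  qed (use va(1) d3 in \<open>simp_all add: cd\<close>)
qed

text \<open>In the chart the velocity is the constant vector \<open>C\<close> times the positive
  factor \<open>conf\<close>, so the curve runs along a straight line without turning back; only its
  parametrisation is not affine.\<close>

lemma geodesic_chart_segment: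
  assumes "geodesic (weight k) \<gamma>" and "\<gamma> 0 \<noteq> \<gamma> 1"
  shows "chart ` path_image \<gamma> = closed_segment (chart (\<gamma> 0)) (chart (\<gamma> 1))" (is ?seg)
    and "\<exists>c>0. chart_deriv (\<gamma> 0) (velocity \<gamma> 0) = c *\<^sub>R (chart (\<gamma> 1) - chart (\<gamma> 0))" (is ?v0)
    and "\<exists>c>0. chart_deriv (\<gamma> 1) (velocity \<gamma> 1) = c *\<^sub>R (chart (\<gamma> 1) - chart (\<gamma> 0))" (is ?v1)
proof -
  obtain C where om: "\<And>t. t \<in> {0..1} \<Longrightarrow> \<gamma> t \<in> Omega"
    and d: "\<And>t i. t \<in> {0..1} \<Longrightarrow>
      ((\<lambda>t. chart (\<gamma> t) $ i) has_real_derivative conf k (\<gamma> t) * C $ i) (at t within {0..1})"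
    and vel: "\<And>t. t \<in> {0..1} \<Longrightarrow> chart_deriv (\<gamma> t) (velocity \<gamma> t) = conf k (\<gamma> t) *\<^sub>R C"
    and cont: "continuous_on {0..1} (\<lambda>t. conf k (\<gamma> t))"
    using geodesic_first_integral[OF assms(1)] by metis
  have s: "conf k (\<gamma> t) > 0" if "t \<in> {0..1}" for t
    using conf_pos[OF k om[OF that]] by simp
  \<comment> \<open>The new time \<open>h\<close> integrates the speed factor, so that the curve
    becomes affine in \<open>h\<close>.\<close>
  define h where "h t = integral {0..t} (\<lambda>t. conf k (\<gamma> t))" for t
  have dh: "(h has_real_derivative conf k (\<gamma> t)) (at t within {0..1})" if "t \<in> {0..1}" for t
    using integral_has_vector_derivative[OF cont that]
    by (simp add: h_def[abs_def] has_real_derivative_iff_has_vector_derivative)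
  have h0: "h 0 = 0" by (simp add: h_def)
  have conth: "continuous_on {0..1} h"
    using dh by (rule DERIV_continuous_on)
  have mono: "h x < h y" if "0 \<le> x" "x < y" "y \<le> 1" for x y
  proof -
    have "\<exists>z\<in>{x<..<y}. h y - h x = (\<lambda>u. u * conf k (\<gamma> z)) (y - x)"
    proof (rule mvt_simple[OF \<open>x < y\<close>])
      fix z assume "x \<le> z" "z \<le> y"
      then have "(h has_derivative (\<lambda>u. conf k (\<gamma> z) * u)) (at z within {0..1})"
        using dh[of z] that unfolding has_field_derivative_def by auto
      then show "(h has_derivative (\<lambda>u. u * conf k (\<gamma> z))) (at z within {x..y})"
        using that by (auto simp: mult.commute intro: has_derivative_subset)
    qed
    then obtain z where "z \<in> {x<..<y}" "h y - h x = (y - x) * conf k (\<gamma> z)" by auto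
    moreover have "(y - x) * conf k (\<gamma> z) > 0"
      using that \<open>z \<in> _\<close> s[of z] by auto
    ultimately show ?thesis by linarith
  qed
  have "((\<lambda>t. chart (\<gamma> t) $ i - h t * C $ i) has_real_derivative 0) (at t within {0..1})"
    if "t \<in> {0..1}" for t i
    by (rule d[OF that] dh[OF that] derivative_eq_intros refl)+ simp
  then have "\<exists>c. \<forall>t\<in>{0..1}. chart (\<gamma> t) $ i - h t * C $ i = c" for i
    by (intro has_field_derivative_zero_constant convex_real_interval)
  then have const: "chart (\<gamma> t) $ i - h t * C $ i = chart (\<gamma> 0) $ i - h 0 * C $ i" if "t \<in> {0..1}" for t i
    using that by (metis atLeastAtMost_iff order_refl zero_le_one)
  have y: "chart (\<gamma> t) = chart (\<gamma> 0) + h t *\<^sub>R C" if "t \<in> {0..1}" for t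
    using const[OF that] unfolding vec_eq_iff by (simp add: h0 diff_eq_eq)
  have L: "h 1 > 0" using mono[of 0 1] h0 by simp
  have C: "C = (1 / h 1) *\<^sub>R (chart (\<gamma> 1) - chart (\<gamma> 0))"
    using y[of 1] L by simp
  show ?v0 using vel[of 0] s[of 0] L C by (intro exI[of _ "conf k (\<gamma> 0) / h 1"]) simp
  show ?v1 using vel[of 1] s[of 1] L C by (intro exI[of _ "conf k (\<gamma> 1) / h 1"]) simp
  have him: "(\<lambda>t. h t / h 1) ` {0..1} = {0..1}"
  proof
    show "(\<lambda>t. h t / h 1) ` {0..1} \<subseteq> {0..1}"
    proof
      fix u assume "u \<in> (\<lambda>t. h t / h 1) ` {0..1}"
      then obtain t where t: "0 \<le> t" "t \<le> 1" "u = h t / h 1" by auto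
      have "0 \<le> h t" using mono[of 0 t] t h0 by (cases "t = 0") auto
      moreover have "h t \<le> h 1" using mono[of t 1] t by (cases "t = 1") auto
      ultimately show "u \<in> {0..1}" using t L by simp
    qed
    show "{0..1} \<subseteq> (\<lambda>t. h t / h 1) ` {0..1}"
    proof
      fix u :: real assume u: "u \<in> {0..1}"
      then have "\<exists>t. 0 \<le> t \<and> t \<le> 1 \<and> h t = u * h 1"
        using L h0 conth by (intro IVT') (auto simp: mult_le_cancel_right1)
      then show "u \<in> (\<lambda>t. h t / h 1) ` {0..1}" using L by (force simp: field_simps)
    qed
  qed
  have "chart ` path_image \<gamma> = (\<lambda>t. chart (\<gamma> t)) ` {0..1}"
    by (auto simp: path_image_def)
  also have "\<dots> = (\<lambda>u. (1 - u) *\<^sub>R chart (\<gamma> 0) + u *\<^sub>R chart (\<gamma> 1)) ` (\<lambda>t. h t / h 1) ` {0..1}"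
    unfolding image_image
  proof (rule image_cong[OF refl])
    fix t :: real assume t: "t \<in> {0..1}"
    have "h t *\<^sub>R C = (h t / h 1) *\<^sub>R (chart (\<gamma> 1) - chart (\<gamma> 0))"
      by (subst C) simp
    with y[OF t] show "chart (\<gamma> t) = (1 - h t / h 1) *\<^sub>R chart (\<gamma> 0) + (h t / h 1) *\<^sub>R chart (\<gamma> 1)"
      by (simp add: algebra_simps)
  qed
  also have "\<dots> = closed_segment (chart (\<gamma> 0)) (chart (\<gamma> 1))"
    unfolding him closed_segment_image_interval ..
  finally show ?seg .
qed

end

section \<open>The disk bounded by a triangle\<close>

text \<open>A line through an interior point leaves the bounded set in both directions, and the
  point lies between the two frontier points met there.\<close>

lemma compact_subset_convex_hull_frontier:
  fixes K :: "'a::euclidean_space set"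
  assumes "compact K"
  shows "K \<subseteq> convex hull (frontier K)"
proof
  fix x assume x: "x \<in> K"
  show "x \<in> convex hull (frontier K)"
  proof (cases "x \<in> interior K")
    case False
    then have "x \<in> frontier K" using x closure_subset by (auto simp: frontier_def)
    then show ?thesis by (rule hull_inc)
  next
    case True
    obtain l :: 'a where l: "l \<noteq> 0" using SOME_Basis nonzero_Basis by blast
    have b: "bounded K" using assms by (rule compact_imp_bounded)
    obtain d where d: "0 < d" "x + d *\<^sub>R l \<in> frontier K"
      using ray_to_frontier[OF b True l] by blast
    obtain e where e: "0 < e" "x + e *\<^sub>R (- l) \<in> frontier K"
      using ray_to_frontier[OF b True, of "- l"] l by auto
    \<comment> \<open>The weights are chosen to cancel the displacements \<open>d\<close> and
      \<open>-e\<close> along \<open>l\<close>.\<close>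
    have "(e / (d + e)) *\<^sub>R (x + d *\<^sub>R l) + (d / (d + e)) *\<^sub>R (x + e *\<^sub>R (- l)) \<in> convex hull (frontier K)"
      using d e by (intro convexD[OF convex_convex_hull] hull_inc) (auto simp flip: add_divide_distrib)
    also have "(e / (d + e)) *\<^sub>R (x + d *\<^sub>R l) + (d / (d + e)) *\<^sub>R (x + e *\<^sub>R (- l)) =
        (e / (d + e) + d / (d + e)) *\<^sub>R x"
      by (simp add: algebra_simps)
    also have "\<dots> = x" using d e by (simp add: add.commute flip: add_divide_distrib)
    finally show ?thesis .
  qed
qed

text \<open>The hull of the frontier gives \<open>K \<subseteq> H\<close>. Conversely, the connected
  set \<open>interior H\<close> meets \<open>K\<close> but not the frontier of \<open>K\<close>,
  hence lies in \<open>K\<close>, and its closure is all of \<open>H\<close>.\<close>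

lemma compact_eq_convex_if_frontier_subset:
  fixes K H :: "'a::euclidean_space set"
  assumes "compact K" "interior K \<noteq> {}" "compact H" "convex H" "frontier K \<subseteq> frontier H"
  shows "K = H"
proof
  have "frontier H \<subseteq> H" using assms(3) compact_imp_closed frontier_subset_closed by blast
  then have "convex hull (frontier K) \<subseteq> H"
    using assms(4,5) by (intro hull_minimal) auto
  then show KH: "K \<subseteq> H" using compact_subset_convex_hull_frontier[OF assms(1)] by blast
  have sub: "interior K \<subseteq> interior H" using KH by (rule interior_mono)
  have "interior H \<subseteq> K"
  proof (rule ccontr)
    assume "\<not> interior H \<subseteq> K"
    moreover have "connected (interior H)"
      using assms(4) by (intro convex_connected convex_interior)
    moreover have "interior H \<inter> K \<noteq> {}" using assms(2) sub interior_subset by blast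
    ultimately have "interior H \<inter> frontier K \<noteq> {}" by (intro connected_Int_frontier) auto
    then show False using assms(5) by (auto simp: frontier_def)
  qed
  then have "closure (interior H) \<subseteq> K"
    using assms(1) by (intro closure_minimal compact_imp_closed)
  moreover have "closure (interior H) = closure H"
    using assms(2,4) sub by (intro convex_closure_interior) auto
  ultimately show "H \<subseteq> K" using closure_subset by blast
qed

lemma continuous_on_chart: "continuous_on S chart"
  unfolding chart_def by (intro continuous_intros) simp

text \<open>The chart is injective and continuous but not onto: invariance of domain gives one
  inclusion, preimages of open sets the other.\<close>

lemma interior_chart_image: "interior (chart ` D) = chart ` interior D"
proof
  have "chart -` interior (chart ` D) \<subseteq> D"
    using interior_subset injD[OF inj_chart] by fast
  moreover have "open (chart -` interior (chart ` D))"
    using continuous_on_chart by (intro open_vimage) auto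
  ultimately have "chart -` interior (chart ` D) \<subseteq> interior D" by (rule interior_maximal)
  then show "interior (chart ` D) \<subseteq> chart ` interior D"
    using interior_subset by fast
  show "chart ` interior D \<subseteq> interior (chart ` D)"
    by (intro interior_maximal image_mono interior_subset invariance_of_domain continuous_on_chart)
      (use inj_chart in \<open>auto intro: inj_on_subset\<close>)
qed

lemma frontier_chart_image:
  assumes "compact D"
  shows "frontier (chart ` D) = chart ` frontier D"
proof -
  have "compact (chart ` D)" using assms continuous_on_chart by (intro compact_continuous_image)
  then show ?thesis
    using assms inj_chart
    by (simp add: frontier_def compact_imp_closed interior_chart_image image_set_diff)
qed

text \<open>Excludes a set that consists of its frontier alone, such as the bare boundary curve of
  the triangle.\<close>

lemma interior_nonempty_if_homeomorphic_cball:
  fixes D :: "'a::euclidean_space set"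
  assumes "D homeomorphic (cball 0 1 :: 'a set)"
  shows "interior D \<noteq> {}"
proof -
  obtain f g where fg: "homeomorphism (cball 0 1 :: 'a set) D f g"
    using homeomorphic_sym[THEN iffD1, OF assms] unfolding homeomorphic_def by blast
  have "open (f ` ball 0 1)"
  proof (rule invariance_of_domain)
    show "continuous_on (ball 0 1) f"
      using fg by (auto simp: homeomorphism_def intro: continuous_on_subset)
    show "inj_on f (ball 0 1)"
      using fg by (intro inj_on_inverseI[of _ g]) (auto simp: homeomorphism_def)
  qed simp
  moreover have "f ` ball 0 1 \<subseteq> D" using fg by (auto simp: homeomorphism_def)
  ultimately have "f ` ball 0 1 \<subseteq> interior D" by (rule interior_maximal[rotated])
  then show ?thesis by auto
qed

lemma chart_image_disk:
  assumes "D homeomorphic (cball 0 1 :: (real^2) set)"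
    and "chart ` frontier D = closed_segment P Q \<union> closed_segment Q R \<union> closed_segment R P"
  shows "chart ` D = convex hull {P, Q, R}"
proof -
  have "compact D" using assms(1) homeomorphic_compactness compact_cball by blast
  moreover have "interior (chart ` D) \<noteq> {}"
    using interior_nonempty_if_homeomorphic_cball[OF assms(1)] by (simp add: interior_chart_image)
  moreover have "frontier (chart ` D) = frontier (convex hull {P, Q, R})"
    using assms(2) \<open>compact D\<close> by (simp add: frontier_chart_image frontier_of_triangle)
  ultimately show ?thesis
    by (intro compact_eq_convex_if_frontier_subset compact_continuous_image continuous_on_chart
        compact_convex_hull) auto
qed

section \<open>Directions pointing into a triangle\<close>

definition cross2 :: "real^2 \<Rightarrow> real^2 \<Rightarrow> real" where
  "cross2 x y = x$1 * y$2 - x$2 * y$1"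

text \<open>Cramer's rule in the plane, cleared of its denominator.\<close>

lemma cross2_basis:
  "cross2 V W *\<^sub>R X = cross2 X W *\<^sub>R V + cross2 V X *\<^sub>R W"
  by (simp add: vec_eq_iff forall_2 cross2_def algebra_simps)

lemma cross2_linear:
  "cross2 (a *\<^sub>R V + b *\<^sub>R W) W = a * cross2 V W" "cross2 V (a *\<^sub>R V + b *\<^sub>R W) = b * cross2 V W"
  by (simp_all add: cross2_def algebra_simps)

lemma DERIV_chart_line:
  "((\<lambda>t. chart (p + t *\<^sub>R u) $ i) has_real_derivative chart_deriv p u $ i) (at 0)"
proof -
  have "((\<lambda>t. exp ((p $ i + t * u $ i) / 2)) has_real_derivative exp (p $ i / 2) * u $ i / 2) (at 0)"
    by (auto intro!: derivative_eq_intros)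
  then show ?thesis by (simp add: chart_def chart_deriv_def)
qed

lemma eventually_pos_if_DERIV_pos:
  fixes f :: "real \<Rightarrow> real"
  assumes "(f has_real_derivative l) (at 0)" "l > 0" "f 0 = 0"
  shows "\<forall>\<^sub>F t in at_right 0. f t > 0"
proof -
  obtain d where "d > 0" "\<And>h. 0 < h \<Longrightarrow> h < d \<Longrightarrow> f 0 < f (0 + h)"
    using DERIV_pos_inc_right[OF assms(1,2)] by blast
  then show ?thesis
    unfolding eventually_at_right_field using assms(3) by (intro exI[of _ d]) auto
qed

text \<open>A straight ray in \<theta> is curved in the chart, so only its initial direction is
  known. The barycentric coordinates at \<open>Q\<close> and \<open>R\<close> start at 0 with
  derivatives \<open>a\<close> and \<open>b\<close>, hence are positive for small times, while their
  sum stays below 1.\<close>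

lemma eventually_in_disk:
  assumes D: "chart ` D = convex hull {chart p, Q, R}"
    and nz: "cross2 (Q - chart p) (R - chart p) \<noteq> 0"
    and v: "chart_deriv p u = a *\<^sub>R (Q - chart p) + b *\<^sub>R (R - chart p)" "a > 0" "b > 0"
  shows "\<forall>\<^sub>F t in at_right 0. p + t *\<^sub>R u \<in> D"
proof -
  define P V W where "P = chart p" and "V = Q - P" and "W = R - P"
  define \<Delta> where "\<Delta> = cross2 V W"
  have nz: "\<Delta> \<noteq> 0" using nz by (simp add: P_def V_def W_def \<Delta>_def)
  define X where "X t = chart (p + t *\<^sub>R u)" for t
  \<comment> \<open>\<open>\<beta>\<close> and \<open>\<gamma>\<close> are the barycentric
    coordinates of \<open>X t\<close> belonging to \<open>Q\<close> and \<open>R\<close>.\<close>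
  define \<beta> where "\<beta> t = cross2 (X t - P) W / \<Delta>" for t
  define \<gamma> where "\<gamma> t = cross2 V (X t - P) / \<Delta>" for t
  have u: "chart_deriv p u = a *\<^sub>R V + b *\<^sub>R W" using v by (simp add: P_def V_def W_def)
  have X: "X t = P + \<beta> t *\<^sub>R V + \<gamma> t *\<^sub>R W" for t
  proof -
    have "X t - P = (1 / \<Delta>) *\<^sub>R (cross2 V W *\<^sub>R (X t - P))" using nz by (simp add: \<Delta>_def)
    also have "\<dots> = \<beta> t *\<^sub>R V + \<gamma> t *\<^sub>R W"
      by (subst cross2_basis) (simp add: \<beta>_def \<gamma>_def scaleR_add_right)
    finally show ?thesis by (simp add: algebra_simps)
  qed
  have X0: "X 0 = P" by (simp add: X_def P_def)
  have dX: "((\<lambda>t. X t $ i) has_real_derivative chart_deriv p u $ i) (at 0)" for i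
    unfolding X_def by (rule DERIV_chart_line)
  have d\<beta>: "(\<beta> has_real_derivative a) (at 0)"
  proof -
    have "(\<beta> has_real_derivative cross2 (chart_deriv p u) W / \<Delta>) (at 0)"
      unfolding \<beta>_def cross2_def using nz by (auto intro!: derivative_eq_intros dX)
    also have "cross2 (chart_deriv p u) W / \<Delta> = a" using nz by (simp add: u cross2_linear \<Delta>_def)
    finally show ?thesis .
  qed
  have d\<gamma>: "(\<gamma> has_real_derivative b) (at 0)"
  proof -
    have "(\<gamma> has_real_derivative cross2 V (chart_deriv p u) / \<Delta>) (at 0)"
      unfolding \<gamma>_def cross2_def using nz by (auto intro!: derivative_eq_intros dX)
    also have "cross2 V (chart_deriv p u) / \<Delta> = b" using nz by (simp add: u cross2_linear \<Delta>_def)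
    finally show ?thesis .
  qed
  have z: "\<beta> 0 = 0" "\<gamma> 0 = 0" by (simp_all add: \<beta>_def \<gamma>_def X0 cross2_def)
  have "((\<lambda>t. \<beta> t + \<gamma> t) \<longlongrightarrow> \<beta> 0 + \<gamma> 0) (at_right 0)"
    using DERIV_isCont[OF d\<beta>] DERIV_isCont[OF d\<gamma>]
    by (intro tendsto_add) (auto simp: isCont_def intro: tendsto_mono[OF at_le])
  then have "\<forall>\<^sub>F t in at_right 0. \<beta> t + \<gamma> t < 1"
    using z by (intro order_tendstoD) auto
  moreover have "\<forall>\<^sub>F t in at_right 0. \<beta> t > 0"
    using d\<beta> v(2) z by (intro eventually_pos_if_DERIV_pos)
  moreover have "\<forall>\<^sub>F t in at_right 0. \<gamma> t > 0"
    using d\<gamma> v(3) z by (intro eventually_pos_if_DERIV_pos)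
  ultimately show ?thesis
  proof eventually_elim
    fix t assume t: "\<beta> t + \<gamma> t < 1" "\<beta> t > 0" "\<gamma> t > 0"
    have "X t = (1 - \<beta> t - \<gamma> t) *\<^sub>R P + \<beta> t *\<^sub>R Q + \<gamma> t *\<^sub>R R"
      by (subst X) (simp add: V_def W_def algebra_simps)
    then have "X t \<in> convex hull {P, Q, R}"
      using t unfolding convex_hull_3 by (intro CollectI exI[of _ "1 - \<beta> t - \<gamma> t"] exI[of _ "\<beta> t"] exI[of _ "\<gamma> t"]) auto
    then have "chart (p + t *\<^sub>R u) \<in> chart ` D" by (simp add: D X_def P_def)
    then show "p + t *\<^sub>R u \<in> D" using injD[OF inj_chart] by fast
  qed
qed

section \<open>Spherical and hyperbolic trigonometry\<close>

text \<open>The Gram matrix of three vectors has diagonal \<open>p, q, r\<close> and off-diagonal entries \<open>a, b, c\<close>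
  opposite to them; this is the law of cosines for the angle at the first vector.\<close>

definition tri_angle :: "real \<Rightarrow> real \<Rightarrow> real \<Rightarrow> real \<Rightarrow> real \<Rightarrow> real \<Rightarrow> real \<Rightarrow> real" where
  "tri_angle k p q r a b c =
    arccos (- k * (p * a - b * c) / (sqrt (- k * (p * q - c\<^sup>2)) * sqrt (- k * (p * r - b\<^sup>2))))"

text \<open>\<open>?G\<close> is the Gram determinant. Its positivity keeps the argument of
  \<open>arccos\<close> strictly between -1 and 1 and yields the sine.\<close>

lemma tri_angle_bounds:
  assumes k: "k = 1 \<or> k = -1" and pos: "p > 0"
    and Db: "- k * (p * r - b\<^sup>2) > 0" and Dc: "- k * (p * q - c\<^sup>2) > 0"
    and G: "p * q * r + 2 * a * b * c - p * a\<^sup>2 - q * b\<^sup>2 - r * c\<^sup>2 > 0" (is "?G > 0")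
  shows "0 < tri_angle k p q r a b c" "tri_angle k p q r a b c < pi"
    and "cos (tri_angle k p q r a b c) =
      - k * (p * a - b * c) / (sqrt (- k * (p * q - c\<^sup>2)) * sqrt (- k * (p * r - b\<^sup>2)))"
    and "sin (tri_angle k p q r a b c) =
      sqrt p * sqrt ?G / (sqrt (- k * (p * q - c\<^sup>2)) * sqrt (- k * (p * r - b\<^sup>2)))"
proof -
  let ?n = "- k * (p * a - b * c)" and ?Db = "- k * (p * r - b\<^sup>2)" and ?Dc = "- k * (p * q - c\<^sup>2)"
  let ?d = "sqrt ?Dc * sqrt ?Db"
  \<comment> \<open>The Desnanot-Jacobi identity for the symmetric 3 by 3 Gram matrix.\<close>
  have id: "?Dc * ?Db = ?n\<^sup>2 + p * ?G"
    using k by (elim disjE) (simp_all add: power2_eq_square algebra_simps)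
  have d: "?d > 0" using Db Dc by simp
  have d2: "?d\<^sup>2 = ?Dc * ?Db"
    unfolding power_mult_distrib using Db Dc by simp
  have pG: "p * ?G > 0" using pos G by simp
  have "\<bar>?n\<bar> < ?d"
  proof (rule power_less_imp_less_base)
    show "\<bar>?n\<bar>\<^sup>2 < ?d\<^sup>2" unfolding power2_abs d2 id using pG by simp
  qed (use d in simp)
  then have x: "-1 < ?n / ?d" "?n / ?d < 1"
    using d by (simp_all add: pos_less_divide_eq pos_divide_less_eq abs_less_iff)
  show "0 < tri_angle k p q r a b c" "tri_angle k p q r a b c < pi"
    unfolding tri_angle_def using arccos_lt_bounded[OF x] by auto
  show "cos (tri_angle k p q r a b c) = ?n / ?d"
    unfolding tri_angle_def using x by (intro cos_arccos) auto
  have "sin (tri_angle k p q r a b c) = sqrt (1 - (?n / ?d)\<^sup>2)"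
    unfolding tri_angle_def using x by (intro sin_arccos) auto
  also have "1 - (?n / ?d)\<^sup>2 = p * ?G / ?d\<^sup>2"
  proof -
    have "1 - (n / d)\<^sup>2 = g / d\<^sup>2" if "d\<^sup>2 = n\<^sup>2 + g" "d \<noteq> 0" for n d g :: real
    proof -
      have "g = d\<^sup>2 - n\<^sup>2" using that(1) by simp
      then show ?thesis using that(2) by (simp add: power_divide diff_divide_distrib)
    qed
    then show ?thesis using d d2 id by (metis less_irrefl)
  qed
  also have "sqrt \<dots> = sqrt p * sqrt ?G / ?d"
    using d by (simp add: real_sqrt_divide real_sqrt_mult)
  finally show "sin (tri_angle k p q r a b c) = sqrt p * sqrt ?G / ?d" .
qed

text \<open>\<open>c / sqrt (p * q)\<close> is the cosine or hyperbolic cosine of the side joining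
  the first two vertices, so the sign of \<open>c - sqrt (p * q)\<close> decides. The cosines
  contribute \<open>c * ?G\<close> to the numerator and the sines
  \<open>sqrt (p * q) * ?G\<close>.\<close>

lemma cos_tri_angle_sum:
  assumes k: "k = 1 \<or> k = -1" and pos: "p > 0" "q > 0" "r > 0"
    and Da: "- k * (q * r - a\<^sup>2) > 0" and Db: "- k * (p * r - b\<^sup>2) > 0" and Dc: "- k * (p * q - c\<^sup>2) > 0"
    and G: "p * q * r + 2 * a * b * c - p * a\<^sup>2 - q * b\<^sup>2 - r * c\<^sup>2 > 0" (is "?G > 0")
  shows "cos (tri_angle k p q r a b c + tri_angle k q r p b c a) + cos (tri_angle k r p q c a b) =
    (c - sqrt (p * q)) * ?G /
      (sqrt (- k * (q * r - a\<^sup>2)) * sqrt (- k * (p * r - b\<^sup>2)) * (- k * (p * q - c\<^sup>2)))"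
proof -
  have G2: "q * r * p + 2 * b * c * a - q * b\<^sup>2 - r * c\<^sup>2 - p * a\<^sup>2 = ?G"
    and G3: "r * p * q + 2 * c * a * b - r * c\<^sup>2 - p * a\<^sup>2 - q * b\<^sup>2 = ?G"
    by (simp_all add: algebra_simps)
  define u v w where "u = sqrt (- k * (q * r - a\<^sup>2))" and "v = sqrt (- k * (p * r - b\<^sup>2))"
    and "w = sqrt (- k * (p * q - c\<^sup>2))"
  have uvw: "u > 0" "v > 0" "w > 0" and w2: "w * w = - k * (p * q - c\<^sup>2)"
    using Da Db Dc by (auto simp: u_def v_def w_def)
  have sw: "sqrt (- k * (r * q - a\<^sup>2)) = u" "sqrt (- k * (r * p - b\<^sup>2)) = v" "sqrt (- k * (q * p - c\<^sup>2)) = w"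
    by (simp_all add: u_def v_def w_def mult.commute)
  note A = tri_angle_bounds[OF k pos(1) Db Dc G, folded v_def w_def]
  note B = tri_angle_bounds[of k q p c r a b, unfolded G2 sw, folded u_def, OF k pos(2) _ _ G]
  note C = tri_angle_bounds[of k r q a p b c, unfolded G3 sw, OF k pos(3) _ _ G]
  have DB: "- k * (q * p - c\<^sup>2) > 0" and DC: "- k * (r * q - a\<^sup>2) > 0" "- k * (r * p - b\<^sup>2) > 0"
    using Da Db Dc by (simp_all add: mult.commute)
  have "cos (tri_angle k p q r a b c + tri_angle k q r p b c a) + cos (tri_angle k r p q c a b) =
    (- k * (p * a - b * c)) / (w * v) * (- k * (q * b - c * a) / (u * w))
     - (sqrt p * sqrt ?G / (w * v)) * (sqrt q * sqrt ?G / (u * w)) + (- k * (r * c - a * b)) / (v * u)"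
    by (simp only: cos_add A(3,4) B(3,4)[OF DB Da] C(3)[OF DC])
  also have "\<dots> = ((- k * (p * a - b * c)) * (- k * (q * b - c * a)) + (- k * (r * c - a * b)) * (w * w)
     - sqrt p * sqrt q * (sqrt ?G * sqrt ?G)) / (u * v * (w * w))"
    using uvw by (simp add: divide_simps mult_ac)
  also have "\<dots> = ((c - sqrt (p * q)) * ?G) / (u * v * (w * w))"
  proof -
    have "(- k * (p * a - b * c)) * (- k * (q * b - c * a)) + (- k * (r * c - a * b)) * (- k * (p * q - c\<^sup>2)) = c * ?G"
      using k by (elim disjE) (simp_all add: power2_eq_square algebra_simps)
    then show ?thesis using G unfolding w2 by (simp add: real_sqrt_mult algebra_simps)
  qed
  finally show ?thesis by (simp only: w2 u_def v_def)
qed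

lemma spherical_angle_sum:
  fixes p q r a b c :: real
  assumes pos: "p > 0" "q > 0" "r > 0"
    and D: "q * r > a\<^sup>2" "p * r > b\<^sup>2" "p * q > c\<^sup>2"
    and G: "p * q * r + 2 * a * b * c - p * a\<^sup>2 - q * b\<^sup>2 - r * c\<^sup>2 > 0"
  shows "tri_angle (-1) p q r a b c + tri_angle (-1) q r p b c a + tri_angle (-1) r p q c a b > pi"
    (is "?A + ?B + ?C > pi")
proof -
  have k: "(-1 :: real) = 1 \<or> (-1 :: real) = -1" by simp
  have A: "0 < ?A" "?A < pi" using tri_angle_bounds[OF k pos(1) _ _ G] D by auto
  have B: "0 < ?B" "?B < pi" using tri_angle_bounds[OF k pos(2), of p c r a b] D G by (auto simp: algebra_simps)
  have C: "0 < ?C" "?C < pi" using tri_angle_bounds[OF k pos(3), of q a p b c] D G by (auto simp: algebra_simps)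
  have "c < sqrt (p * q)" using D(3) by (rule real_less_rsqrt)
  then have "cos (?A + ?B) + cos ?C < 0"
    using cos_tri_angle_sum[OF k pos _ _ _ G] D G
    by (simp add: divide_neg_pos mult_neg_pos mult_pos_pos)
  then have lt: "cos (?A + ?B) < cos (pi - ?C)" by simp
  show ?thesis
  proof (rule ccontr)
    \<comment> \<open>Now \<open>?A + ?B\<close> and \<open>pi - ?C\<close> both lie in [0, pi],
      where cosine decreases.\<close>
    assume "\<not> ?thesis"
    then have "cos (pi - ?C) \<le> cos (?A + ?B)"
      using A B C by (intro cos_monotone_0_pi_le) auto
    with lt show False by simp
  qed
qed

text \<open>Each cosine inequality leaves an exceptional branch. If the branches
  \<open>A + B > pi + C\<close> and \<open>B + C > pi + A\<close> both held, adding them would give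
  \<open>B > pi\<close>.\<close>

lemma hyperbolic_angle_sum:
  fixes p q r a b c :: real
  assumes pos: "p > 0" "q > 0" "r > 0" "a > 0" "b > 0" "c > 0"
    and D: "q * r < a\<^sup>2" "p * r < b\<^sup>2" "p * q < c\<^sup>2"
    and G: "p * q * r + 2 * a * b * c - p * a\<^sup>2 - q * b\<^sup>2 - r * c\<^sup>2 > 0"
  shows "tri_angle 1 p q r a b c + tri_angle 1 q r p b c a + tri_angle 1 r p q c a b < pi"
proof -
  have *: "tri_angle 1 p q r a b c + tri_angle 1 q r p b c a + tri_angle 1 r p q c a b < pi \<or>
      tri_angle 1 p q r a b c + tri_angle 1 q r p b c a > pi + tri_angle 1 r p q c a b"
    if pos: "p > 0" "q > 0" "r > 0" "c > 0"
      and D: "q * r < a\<^sup>2" "p * r < b\<^sup>2" "p * q < c\<^sup>2"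
      and G: "p * q * r + 2 * a * b * c - p * a\<^sup>2 - q * b\<^sup>2 - r * c\<^sup>2 > 0"
    for p q r a b c :: real
  proof -
    have k: "(1 :: real) = 1 \<or> (1 :: real) = -1" by simp
    let ?A = "tri_angle 1 p q r a b c" and ?B = "tri_angle 1 q r p b c a" and ?C = "tri_angle 1 r p q c a b"
    have A: "0 < ?A" using tri_angle_bounds[OF k pos(1) _ _ G] D by auto
    have A2: "?A < pi" using tri_angle_bounds[OF k pos(1) _ _ G] D by auto
    have B: "0 < ?B" "?B < pi" using tri_angle_bounds[OF k pos(2), of p c r a b] D G by (auto simp: algebra_simps)
    have C: "0 < ?C" "?C < pi" using tri_angle_bounds[OF k pos(3), of q a p b c] D G by (auto simp: algebra_simps)
    have "c > sqrt (p * q)" using D(3) pos by (intro real_less_lsqrt) auto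
    then have "cos (?A + ?B) + cos ?C > 0"
      using cos_tri_angle_sum[OF k pos(1-3) _ _ _ G] D G
      by (simp add: divide_pos_pos)
    then have lt: "cos (pi - ?C) < cos (?A + ?B)" by simp
    show "?A + ?B + ?C < pi \<or> ?A + ?B > pi + ?C"
    proof (rule ccontr)
      assume n: "\<not> ?thesis"
      have "cos (?A + ?B) \<le> cos (pi - ?C)"
      proof (cases "?A + ?B \<le> pi")
        case True
        then show ?thesis using n A B C by (intro cos_monotone_0_pi_le) auto
      next
        case False
        \<comment> \<open>Beyond pi the sum is reflected back into the interval where cosine is
          monotone.\<close>
        have "cos (2 * pi - (?A + ?B)) \<le> cos (pi - ?C)"
          using False n A A2 B C by (intro cos_monotone_0_pi_le) auto
        then show ?thesis by (simp add: cos_diff)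
      qed
      with lt show False by simp
    qed
  qed
  have 1: "tri_angle 1 p q r a b c + tri_angle 1 q r p b c a + tri_angle 1 r p q c a b < pi \<or>
      tri_angle 1 p q r a b c + tri_angle 1 q r p b c a > pi + tri_angle 1 r p q c a b"
    using assms by (intro *) auto
  have 2: "tri_angle 1 q r p b c a + tri_angle 1 r p q c a b + tri_angle 1 p q r a b c < pi \<or>
      tri_angle 1 q r p b c a + tri_angle 1 r p q c a b > pi + tri_angle 1 p q r a b c"
    using assms by (intro *) (auto simp: algebra_simps)
  have "tri_angle 1 r p q c a b < pi"
    using tri_angle_bounds(2)[of 1 r q a p b c] assms by (auto simp: algebra_simps)
  moreover have "tri_angle 1 q r p b c a < pi"
    using tri_angle_bounds(2)[of 1 q p c r a b] assms by (auto simp: algebra_simps)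
  ultimately show ?thesis using 1 2 by linarith
qed

section \<open>Interior angles\<close>

text \<open>For \<open>k = -1\<close> and \<open>k = 1\<close> these are the Euclidean and the Lorentzian inner product of \<open>(1, P)\<close>
  and \<open>(1, Q)\<close>.\<close>

definition bform :: "real \<Rightarrow> real^2 \<Rightarrow> real^2 \<Rightarrow> real" where
  "bform k P Q = 1 - k * (P \<bullet> Q)"

lemma bform_commute: "bform k P Q = bform k Q P"
  by (simp add: bform_def inner_commute)

lemma inner_vec2: "P \<bullet> Q = P$1 * Q$1 + P$2 * Q$2" for P Q :: "real^2"
  by (simp add: inner_vec_def sum_2)

context
  fixes k :: real
  assumes k: "k = 1 \<or> k = -1"
begin

lemma conf_eq_bform: "conf k \<theta> = bform k (chart \<theta>) (chart \<theta>)"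
  by (simp add: bform_def conf_chart)

text \<open>On the left is the metric applied to the chart directions of two sides, up to a positive
  factor; on the right, the numerator in the law of cosines.\<close>

lemma bform_secant:
  "bform k P P * ((Q - P) \<bullet> (R - P)) + k * (P \<bullet> (Q - P)) * (P \<bullet> (R - P)) =
    - k * (bform k P P * bform k Q R - bform k P R * bform k P Q)"
proof -
  define V W where "V = Q - P" and "W = R - P"
  have QR: "Q = P + V" "R = P + W" by (simp_all add: V_def W_def)
  define s x y E where "s = bform k P P" and "x = P \<bullet> V" and "y = P \<bullet> W" and "E = V \<bullet> W"
  have B: "bform k P P = s" "bform k P Q = s - k * x" "bform k P R = s - k * y"
      "bform k Q R = s - k * x - k * y - k * E"
    by (simp_all add: bform_def QR inner_add inner_commute algebra_simps s_def x_def y_def E_def)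
  have "s * E + k * x * y = - k * (s * (s - k * x - k * y - k * E) - (s - k * y) * (s - k * x))"
    using k by (elim disjE) (simp_all add: algebra_simps)
  then show ?thesis unfolding B by (simp only: V_def W_def x_def y_def E_def)
qed

text \<open>The left-hand side is the Gram determinant of \<open>(1, P), (1, Q), (1, R)\<close>.\<close>

lemma gram_bform:
  "bform k P P * bform k Q Q * bform k R R + 2 * bform k Q R * bform k P R * bform k P Q
     - bform k P P * (bform k Q R)\<^sup>2 - bform k Q Q * (bform k P R)\<^sup>2 - bform k R R * (bform k P Q)\<^sup>2 =
   (cross2 (Q - P) (R - P))\<^sup>2"
proof -
  define V W where "V = Q - P" and "W = R - P"
  have QR: "Q = P + V" "R = P + W" by (simp_all add: V_def W_def)
  define s x y A C E where "s = bform k P P" and "x = P \<bullet> V" and "y = P \<bullet> W"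
    and "A = V \<bullet> V" and "C = W \<bullet> W" and "E = V \<bullet> W"
  have B: "bform k P P = s" "bform k P Q = s - k * x" "bform k P R = s - k * y"
      "bform k Q Q = s - 2 * k * x - k * A" "bform k R R = s - 2 * k * y - k * C"
      "bform k Q R = s - k * x - k * y - k * E"
    by (simp_all add: bform_def QR inner_add inner_commute algebra_simps s_def x_def y_def A_def C_def E_def)
  have "bform k P P * bform k Q Q * bform k R R + 2 * bform k Q R * bform k P R * bform k P Q
     - bform k P P * (bform k Q R)\<^sup>2 - bform k Q Q * (bform k P R)\<^sup>2 - bform k R R * (bform k P Q)\<^sup>2
    = s * (A * C - E\<^sup>2) + k * (x\<^sup>2 * C + y\<^sup>2 * A - 2 * x * y * E)"
    unfolding B using k by (elim disjE) (simp_all add: algebra_simps power2_eq_square)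
  \<comment> \<open>Lagrange's identity in the plane; the next line is its companion for the
    quadratic form at \<open>P\<close>.\<close>
  also have "A * C - E\<^sup>2 = (cross2 V W)\<^sup>2"
    by (simp add: A_def C_def E_def cross2_def inner_vec2 algebra_simps power2_eq_square)
  also have "x\<^sup>2 * C + y\<^sup>2 * A - 2 * x * y * E = (P \<bullet> P) * (cross2 V W)\<^sup>2"
    by (simp add: x_def y_def A_def C_def E_def cross2_def inner_vec2 algebra_simps power2_eq_square)
  also have "s * (cross2 V W)\<^sup>2 + k * ((P \<bullet> P) * (cross2 V W)\<^sup>2) = (cross2 V W)\<^sup>2"
    by (simp add: s_def bform_def algebra_simps)
  finally show ?thesis by (simp only: V_def W_def)
qed

lemma bform_pos: "p \<in> Omega \<Longrightarrow> bform k (chart p) (chart p) > 0"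
  using conf_pos[OF k] by (simp add: conf_eq_bform)

text \<open>By \<open>bform_secant\<close> with \<open>R = Q\<close> this is the squared length of a
  nonzero vector. It is a sum with a positive and a nonnegative term for \<open>k = 1\<close>, and
  positive by Cauchy-Schwarz for \<open>k = -1\<close>.\<close>

lemma bform_separated:
  assumes "p \<in> Omega" "P = chart p" "P \<noteq> Q"
  shows "- k * (bform k P P * bform k Q Q - (bform k P Q)\<^sup>2) > 0"
proof -
  define V where "V = Q - P"
  have V: "V \<bullet> V > 0" using assms by (simp add: V_def)
  have s: "bform k P P > 0" using bform_pos assms by simp
  have "bform k P P * (V \<bullet> V) + k * (P \<bullet> V)\<^sup>2 > 0"
    using k
  proof
    assume "k = 1"
    moreover have "bform k P P * (V \<bullet> V) > 0" using s V by simp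
    ultimately show ?thesis by (simp add: add_pos_nonneg)
  next
    assume "k = -1"
    moreover have "(P \<bullet> V)\<^sup>2 \<le> (P \<bullet> P) * (V \<bullet> V)" by (rule Cauchy_Schwarz_ineq)
    moreover have "bform (-1) P P * (V \<bullet> V) = V \<bullet> V + (P \<bullet> P) * (V \<bullet> V)"
      by (simp add: bform_def algebra_simps)
    ultimately have "(P \<bullet> V)\<^sup>2 < bform (-1) P P * (V \<bullet> V)" using V by linarith
    then show ?thesis using \<open>k = -1\<close> by simp
  qed
  then show ?thesis
    using bform_secant[of P Q Q] by (simp add: V_def power2_eq_square mult.assoc)
qed

lemma g_inner_secant:
  assumes "p \<in> Omega" "P = chart p"
    and "chart_deriv p v = a *\<^sub>R (Q - P)" "chart_deriv p w = b *\<^sub>R (R - P)"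
  shows "g_inner (weight k) p v w = 4 * a * b / (bform k P P)\<^sup>2 *
    (- k * (bform k P P * bform k Q R - bform k P R * bform k P Q))"
proof -
  have "bform k P P \<noteq> 0" using bform_pos assms(1,2) by force
  then show ?thesis
    unfolding g_inner_chart[OF k assms(1)] assms(3,4) conf_eq_bform assms(2)[symmetric] bform_secant[symmetric]
    by (simp add: divide_simps) (simp add: algebra_simps power2_eq_square)
qed

text \<open>The bisector has positive components along both sides, so it enters the triangle and the
  convex branch applies. The speeds \<open>a\<close>, \<open>b\<close> cancel in the
  quotient.\<close>

lemma interior_angle_chart:
  assumes p: "p \<in> Omega" "P = chart p" "pathstart \<delta> = p"
    and D: "chart ` D = convex hull {P, Q, R}"
    and nz: "cross2 (Q - P) (R - P) \<noteq> 0"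
    and v: "chart_deriv p (- velocity \<gamma> 1) = a *\<^sub>R (Q - P)" "a > 0"
    and w: "chart_deriv p (velocity \<delta> 0) = b *\<^sub>R (R - P)" "b > 0"
  shows "interior_angle (weight k) D \<gamma> \<delta> =
    tri_angle k (bform k P P) (bform k Q Q) (bform k R R) (bform k Q R) (bform k P R) (bform k P Q)"
proof -
  define vv ww where "vv = - velocity \<gamma> 1" and "ww = velocity \<delta> 0"
  note v = v[folded vv_def] and w = w[folded ww_def]
  have ne: "P \<noteq> Q" "P \<noteq> R" using nz by (auto simp: cross2_def)
  define NQ NR where "NQ = - k * (bform k P P * bform k Q Q - (bform k P Q)\<^sup>2)"
    and "NR = - k * (bform k P P * bform k R R - (bform k P R)\<^sup>2)"
  have N: "NQ > 0" "NR > 0"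
    using bform_separated[OF p(1,2)] ne unfolding NQ_def NR_def by blast+
  define s where "s = bform k P P"
  have s: "s > 0" using bform_pos p(1,2) by (simp add: s_def)
  have "g_norm (weight k) p vv = sqrt ((2 * a / s)\<^sup>2 * NQ)"
    unfolding g_norm_def g_inner_secant[OF p(1,2) v(1) v(1)] NQ_def s_def
    by (simp add: power2_eq_square power_divide)
  then have nv: "g_norm (weight k) p vv = 2 * a / s * sqrt NQ"
    using s v(2) by (simp add: real_sqrt_mult)
  have "g_norm (weight k) p ww = sqrt ((2 * b / s)\<^sup>2 * NR)"
    unfolding g_norm_def g_inner_secant[OF p(1,2) w(1) w(1)] NR_def s_def
    by (simp add: power2_eq_square power_divide)
  then have nw: "g_norm (weight k) p ww = 2 * b / s * sqrt NR"
    using s w(2) by (simp add: real_sqrt_mult)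
  have pos: "g_norm (weight k) p vv > 0" "g_norm (weight k) p ww > 0"
    unfolding nv nw using s v(2) w(2) N by simp_all
  define u where "u = vv /\<^sub>R g_norm (weight k) p vv + ww /\<^sub>R g_norm (weight k) p ww"
  have "chart_deriv p u = inverse (g_norm (weight k) p vv) *\<^sub>R chart_deriv p vv +
      inverse (g_norm (weight k) p ww) *\<^sub>R chart_deriv p ww"
    by (simp add: u_def chart_deriv_def vec_eq_iff algebra_simps add_divide_distrib)
  then have "chart_deriv p u = (inverse (g_norm (weight k) p vv) * a) *\<^sub>R (Q - chart p) +
      (inverse (g_norm (weight k) p ww) * b) *\<^sub>R (R - chart p)"
    using v(1) w(1) p(2) by simp
  then have ev: "\<forall>\<^sub>F t in at_right 0. p + t *\<^sub>R u \<in> D"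
    by (rule eventually_in_disk[rotated 2]) (use D nz p(2) v(2) w(2) pos in auto)
  have cancel: "4 * a * b / s\<^sup>2 * n / (2 * a / s * x * (2 * b / s * y)) = n / (x * y)" for n x y
    using s v(2) w(2) by (cases "x = 0 \<or> y = 0") (auto simp: field_simps power2_eq_square)
  have "interior_angle (weight k) D \<gamma> \<delta> = g_angle (weight k) p vv ww"
    using ev unfolding interior_angle_def Let_def p(3) vv_def[symmetric] ww_def[symmetric] u_def[symmetric]
    by simp
  also have "\<dots> = arccos ((- k * (s * bform k Q R - bform k P R * bform k P Q)) / (sqrt NQ * sqrt NR))"
    unfolding g_angle_def nv nw
    unfolding g_inner_secant[OF p(1,2) v(1) w(1)] s_def[symmetric] cancel ..
  finally show ?thesis unfolding tri_angle_def NQ_def NR_def s_def .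
qed

lemma cross2_zero_imp_collinear:
  assumes "cross2 (Q - P) (R - P) = 0"
  shows "collinear {P, Q, R}"
proof (cases "Q = P")
  case False
  define V W where "V = Q - P" and "W = R - P"
  have V: "V \<bullet> V \<noteq> 0" using False by (simp add: V_def)
  have "V$1 * W$2 = V$2 * W$1" using assms by (simp add: cross2_def V_def W_def)
  then have "(V \<bullet> V) *\<^sub>R W = (W \<bullet> V) *\<^sub>R V"
    by (auto simp: vec_eq_iff forall_2 inner_vec2 algebra_simps)
  then have "W = ((W \<bullet> V) / (V \<bullet> V)) *\<^sub>R V"
    using V by (metis divide_inverse mult.commute scaleR_scaleR left_inverse scaleR_one)
  then have "collinear {0, V, W}" unfolding collinear_lemma by blast
  then have "collinear {Q, P, R}" unfolding V_def W_def by (simp add: collinear_3[of Q P R])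
  then show ?thesis by (simp add: insert_commute)
qed simp

lemma geodesic_segment_chart:
  assumes "geodesic_segment (weight k) p q \<gamma>"
  shows "p \<in> Omega" "q \<in> Omega" "p \<noteq> q" "pathstart \<gamma> = p"
    "chart ` path_image \<gamma> = closed_segment (chart p) (chart q)"
    "\<exists>c>0. chart_deriv p (velocity \<gamma> 0) = c *\<^sub>R (chart q - chart p)"
    "\<exists>c>0. chart_deriv q (- velocity \<gamma> 1) = c *\<^sub>R (chart p - chart q)"
proof -
  have g: "geodesic (weight k) \<gamma>" "arc \<gamma>" and e: "\<gamma> 0 = p" "\<gamma> 1 = q"
    using assms by (auto simp: geodesic_segment_def pathstart_def pathfinish_def)
  have ne: "\<gamma> 0 \<noteq> \<gamma> 1" using arc_distinct_ends[OF g(2)] by (simp add: pathstart_def pathfinish_def)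
  show "p \<in> Omega" "q \<in> Omega" using g(1) e unfolding geodesic_def by force+
  show "p \<noteq> q" "pathstart \<gamma> = p" using ne e by (auto simp: pathstart_def)
  note seg = geodesic_chart_segment[OF k g(1) ne, unfolded e]
  show "chart ` path_image \<gamma> = closed_segment (chart p) (chart q)" by (rule seg)
  show "\<exists>c>0. chart_deriv p (velocity \<gamma> 0) = c *\<^sub>R (chart q - chart p)" by (rule seg)
  obtain c where c: "c > 0" "chart_deriv q (velocity \<gamma> 1) = c *\<^sub>R (chart q - chart p)" using seg(3) by blast
  have "chart_deriv q (- velocity \<gamma> 1) = - chart_deriv q (velocity \<gamma> 1)"
    by (simp add: chart_deriv_def vec_eq_iff)
  also have "\<dots> = c *\<^sub>R (chart p - chart q)" unfolding c(2) by (simp add: algebra_simps)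
  finally show "\<exists>c>0. chart_deriv q (- velocity \<gamma> 1) = c *\<^sub>R (chart p - chart q)" using c(1) by blast
qed

text \<open>Otherwise one vertex would lie on the opposite side, which would then meet another side
  outside their common vertex.\<close>

lemma geodesic_triangle_noncollinear:
  assumes "geodesic_triangle (weight k) p q r a b c D"
  shows "\<not> collinear {chart p, chart q, chart r}"
proof
  note T = assms[unfolded geodesic_triangle_def]
  have a: "geodesic_segment (weight k) p q a" and b: "geodesic_segment (weight k) q r b"
    and c: "geodesic_segment (weight k) r p c" using T by auto
  note A = geodesic_segment_chart[OF a] and B = geodesic_segment_chart[OF b] and C = geodesic_segment_chart[OF c]
  have mem: "x \<in> path_image \<gamma>" if "chart x \<in> chart ` path_image \<gamma>" for x \<gamma>
    using that injD[OF inj_chart] by fast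
  have ends: "p \<in> path_image a" "q \<in> path_image a" "r \<in> path_image c" "p \<in> path_image c"
    using a c pathstart_in_path_image[of a] pathfinish_in_path_image[of a]
      pathstart_in_path_image[of c] pathfinish_in_path_image[of c]
    unfolding geodesic_segment_def by auto
  assume "collinear {chart p, chart q, chart r}"
  then consider "chart p \<in> closed_segment (chart q) (chart r)" | "chart q \<in> closed_segment (chart r) (chart p)"
    | "chart r \<in> closed_segment (chart p) (chart q)"
    unfolding collinear_between_cases between_mem_segment by blast
  then show False
  proof cases
    case 1
    then have "p \<in> path_image b" by (intro mem) (simp add: B(5))
    then have "p \<in> path_image a \<inter> path_image b" using ends by blast
    then show False using T A(3) by simp
  next
    case 2
    then have "q \<in> path_image c" by (intro mem) (simp add: C(5))
    then have "q \<in> path_image c \<inter> path_image a" using ends by blast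
    then show False using T A(3) by simp
  next
    case 3
    then have "r \<in> path_image a" by (intro mem) (simp add: A(5))
    then have "r \<in> path_image c \<inter> path_image a" using ends by blast
    then show False using T C(3) by simp
  qed
qed

text \<open>The order \<open>p\<close>, \<open>r\<close>, \<open>q\<close> arises because at
  \<open>p\<close> the arriving side comes from \<open>r\<close> and the departing one goes to
  \<open>q\<close>; it puts the three angles into the cyclic form of the trigonometric
  lemmas.\<close>

lemma angle_sum_eq:
  assumes "geodesic_triangle (weight k) p q r a b c D"
  defines "B \<equiv> \<lambda>x y. bform k (chart x) (chart y)"
  shows "angle_sum (weight k) D a b c =
    tri_angle k (B p p) (B r r) (B q q) (B r q) (B p q) (B p r) +
    tri_angle k (B r r) (B q q) (B p p) (B p q) (B p r) (B r q) +
    tri_angle k (B q q) (B p p) (B r r) (B p r) (B r q) (B p q)"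
    and "cross2 (chart r - chart p) (chart q - chart p) \<noteq> 0"
proof -
  note T = assms(1)[unfolded geodesic_triangle_def]
  have a: "geodesic_segment (weight k) p q a" and b: "geodesic_segment (weight k) q r b"
    and c: "geodesic_segment (weight k) r p c" using T by auto
  note a' = geodesic_segment_chart[OF a] and b' = geodesic_segment_chart[OF b] and c' = geodesic_segment_chart[OF c]
  have D: "chart ` D = convex hull {chart p, chart q, chart r}"
    using T by (intro chart_image_disk) (auto simp: image_Un a'(5) b'(5) c'(5))
  have nc: "\<not> collinear {chart p, chart q, chart r}"
    using assms(1) by (rule geodesic_triangle_noncollinear)
  have perm: "{chart p, chart r, chart q} = {chart p, chart q, chart r}"
    "{chart r, chart q, chart p} = {chart p, chart q, chart r}"
    "{chart q, chart p, chart r} = {chart p, chart q, chart r}" by auto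
  have Dp: "chart ` D = convex hull {chart p, chart r, chart q}"
      "chart ` D = convex hull {chart r, chart q, chart p}"
      "chart ` D = convex hull {chart q, chart p, chart r}"
    unfolding perm by (rule D)+
  show np: "cross2 (chart r - chart p) (chart q - chart p) \<noteq> 0"
    using nc cross2_zero_imp_collinear perm by metis
  have nr: "cross2 (chart q - chart r) (chart p - chart r) \<noteq> 0"
    using nc cross2_zero_imp_collinear perm by metis
  have nq: "cross2 (chart p - chart q) (chart r - chart q) \<noteq> 0"
    using nc cross2_zero_imp_collinear perm by metis
  obtain a0 a1 where va: "a0 > 0" "chart_deriv p (velocity a 0) = a0 *\<^sub>R (chart q - chart p)"
      "a1 > 0" "chart_deriv q (- velocity a 1) = a1 *\<^sub>R (chart p - chart q)" using a'(6,7) by blast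
  obtain b0 b1 where vb: "b0 > 0" "chart_deriv q (velocity b 0) = b0 *\<^sub>R (chart r - chart q)"
      "b1 > 0" "chart_deriv r (- velocity b 1) = b1 *\<^sub>R (chart q - chart r)" using b'(6,7) by blast
  obtain c0 c1 where vc: "c0 > 0" "chart_deriv r (velocity c 0) = c0 *\<^sub>R (chart p - chart r)"
      "c1 > 0" "chart_deriv p (- velocity c 1) = c1 *\<^sub>R (chart r - chart p)" using c'(6,7) by blast
  note 1 = interior_angle_chart[OF a'(1) refl a'(4) Dp(1) np vc(4,3) va(2,1)]
  note 2 = interior_angle_chart[OF b'(1) refl b'(4) Dp(3) nq va(4,3) vb(2,1)]
  note 3 = interior_angle_chart[OF c'(1) refl c'(4) Dp(2) nr vb(4,3) vc(2,1)]
  show "angle_sum (weight k) D a b c =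
    tri_angle k (B p p) (B r r) (B q q) (B r q) (B p q) (B p r) +
    tri_angle k (B r r) (B q q) (B p p) (B p q) (B p r) (B r q) +
    tri_angle k (B q q) (B p p) (B r r) (B p r) (B r q) (B p q)"
    unfolding angle_sum_def 1 2 3 B_def
    by (simp add: bform_commute[of k "chart q" "chart p"] bform_commute[of k "chart r" "chart p"]
        bform_commute[of k "chart q" "chart r"])
qed

end

section \<open>The two angle sums\<close>

text \<open>The mixed value is at least the mean of the two diagonal ones. In Lorentzian terms, both
  lifts lie in the same half of the light cone.\<close>

lemma bform_pos_hyperbolic:
  assumes "p \<in> Omega" "q \<in> Omega"
  shows "bform 1 (chart p) (chart q) > 0"
proof -
  have "(chart p - chart q) \<bullet> (chart p - chart q) \<ge> 0" by (rule inner_ge_zero)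
  then have "2 * (chart p \<bullet> chart q) \<le> chart p \<bullet> chart p + chart q \<bullet> chart q"
    by (simp add: inner_diff inner_commute)
  moreover have "bform 1 (chart p) (chart p) > 0" "bform 1 (chart q) (chart q) > 0"
    using assms by (auto intro: bform_pos)
  ultimately show ?thesis by (simp add: bform_def)
qed

lemma angle_sum_gt_pi:
  assumes "geodesic_triangle 1 p q r a b c D"
  shows "angle_sum 1 D a b c > pi"
proof -
  have k: "(-1 :: real) = 1 \<or> (-1 :: real) = -1" by simp
  have al: "weight (-1) = 1" by simp
  have T: "geodesic_triangle (weight (-1)) p q r a b c D" using assms by simp
  have seg: "geodesic_segment (weight (-1)) p q a" "geodesic_segment (weight (-1)) q r b"
    "geodesic_segment (weight (-1)) r p c"
    using T unfolding geodesic_triangle_def by blast+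
  have om: "p \<in> Omega" "q \<in> Omega" "r \<in> Omega" and ne: "p \<noteq> q" "q \<noteq> r" "r \<noteq> p"
    using seg geodesic_segment_chart(1,3)[OF k] by blast+
  have ne: "chart p \<noteq> chart q" "chart r \<noteq> chart q" "chart p \<noteq> chart r"
    using ne injD[OF inj_chart] by metis+
  note sum = angle_sum_eq[OF k T, unfolded al]
  show ?thesis
    unfolding sum(1)
    \<comment> \<open>Distinct vertices give the signs of the 2 by 2 minors; the Gram determinant is
      the square of the nonzero \<open>cross2\<close>.\<close>
    using bform_separated[OF k om(3) refl ne(2)] bform_separated[OF k om(1) refl ne(1)]
      bform_separated[OF k om(1) refl ne(3)] sum(2)
    by (intro spherical_angle_sum bform_pos[OF k] om) (simp_all add: gram_bform[OF k])
qed

lemma angle_sum_lt_pi: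
  assumes "geodesic_triangle 0 p q r a b c D"
  shows "angle_sum 0 D a b c < pi"
proof -
  have k: "(1 :: real) = 1 \<or> (1 :: real) = -1" by simp
  have al: "weight 1 = 0" by simp
  have T: "geodesic_triangle (weight 1) p q r a b c D" using assms by simp
  have seg: "geodesic_segment (weight 1) p q a" "geodesic_segment (weight 1) q r b"
    "geodesic_segment (weight 1) r p c"
    using T unfolding geodesic_triangle_def by blast+
  have om: "p \<in> Omega" "q \<in> Omega" "r \<in> Omega" and ne: "p \<noteq> q" "q \<noteq> r" "r \<noteq> p"
    using seg geodesic_segment_chart(1,3)[OF k] by blast+
  have ne: "chart p \<noteq> chart q" "chart r \<noteq> chart q" "chart p \<noteq> chart r"
    using ne injD[OF inj_chart] by metis+
  note sum = angle_sum_eq[OF k T, unfolded al]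
  show ?thesis
    unfolding sum(1)
    using bform_separated[OF k om(3) refl ne(2)] bform_separated[OF k om(1) refl ne(1)]
      bform_separated[OF k om(1) refl ne(3)] sum(2)
    by (intro hyperbolic_angle_sum bform_pos[OF k] bform_pos_hyperbolic om) (simp_all add: gram_bform[OF k])
qed

theorem theorem8p3:
  fixes \<theta> \<theta>' :: "real^2"
  assumes "\<theta> \<in> Omega" and "\<theta>' \<in> Diag" and "\<theta> \<notin> Diag"
  shows "(\<forall>a b c D.
            geodesic_triangle 1 \<theta> (midpoint_diag \<theta>) \<theta>' a b c D \<and> path_image b \<subseteq> Diag \<and>
            shorter_arc 1 a \<and> shorter_arc 1 b \<and> shorter_arc 1 c
            \<longrightarrow> angle_sum 1 D a b c > pi)
       \<and> (\<forall>a b c D.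
            geodesic_triangle 0 \<theta> (midpoint_diag \<theta>) \<theta>' a b c D \<and> path_image b \<subseteq> Diag
            \<longrightarrow> angle_sum 0 D a b c < pi)"
  using angle_sum_gt_pi angle_sum_lt_pi by blast

end
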